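(* Let $m$ be a positive integer, let $1<p_1,\ldots,p_m<\infty$, let $p$ be defined by $\frac1p=\sum_{i=1}^m\frac1{p_i}$, and write $\vec{p}=(p_1,\ldots,p_m)$. Suppose $\vec{w}=(w_1,\ldots,w_m)\in A_{\vec{p}}$, where $w_1,\ldots,w_m$ are weights on $\mathbb{R}^n$. If $w_i\in A_\infty$ for every $1\le i\le m$, then $w_i\in A_{p_i}$ for every $1\le i\le m$.
   Context: A weight is a measurable function on $\mathbb{R}^n$ that is positive and finite almost everywhere. All cubes have sides parallel to the coordinate axes; suprema below are over all cubes $Q\subset\mathbb{R}^n$. For $1<q<\infty$, $q'=\frac{q}{q-1}$. For $1<q<\infty$, a weight $w$ is in $A_q$ if $$[w]_{A_q}=\sup_Q\left(\frac{1}{|Q|}\int_Q w\,dx\right)\left(\frac{1}{|Q|}\int_Q w^{1-q'}\,dx\right)^{q-1}<\infty,$$ and $A_\infty=\bigcup_{1<q<\infty}A_q$. Given $\vec{p}=(p_1,\ldots,p_m)$ with $1<p_i<\infty$, $\frac1p=\sum_{i=1}^m\frac1{p_i}$, weights $\vec{w}=(w_1,\ldots,w_m)$, and $w=\prod_{i=1}^m w_i^{\frac{p}{p_i}}$, we say $\vec{w}\in A_{\vec{p}}$ if $$[\vec{w}]_{A_{\vec{p}}}=\sup_Q\left(\frac{1}{|Q|}\int_Q w\,dx\right)^{\frac1p}\prod_{i=1}^m\left(\frac{1}{|Q|}\int_Q w_i^{1-p_i'}\,dx\right)^{\frac1{p_i'}}<\infty.$$ *)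

theory Defs
  imports "HOL-Analysis.Analysis"
begin

text \<open>Real powers on \<open>[0,\<infinity>]\<close>, with \<open>0\<close> and \<open>\<infinity>\<close> treated as limits; \<open>x\<close> to the power \<open>0\<close> is \<open>1\<close>.\<close>

definition ennpow :: "ennreal \<Rightarrow> real \<Rightarrow> ennreal" where
  "ennpow x a =
     (if a = 0 then 1
      else if x = 0 then (if a > 0 then 0 else \<infinity>)
      else if x = \<infinity> then (if a > 0 then \<infinity> else 0)
      else ennreal (enn2real x powr a))"

definition conj_exp :: "real \<Rightarrow> real" where
  "conj_exp q = q / (q - 1)"

definition weight :: "(real ^ 'n \<Rightarrow> ennreal) \<Rightarrow> bool" where
  "weight w \<longleftrightarrow> w \<in> borel_measurable lebesgue \<and> (AE x in lebesgue. 0 < w x \<and> w x < \<infinity>)"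

definition cubes :: "(real ^ 'n) set set" where
  "cubes = {cbox a (\<chi> i. a $ i + l) | a l. 0 < l}"

definition average :: "(real ^ 'n) set \<Rightarrow> (real ^ 'n \<Rightarrow> ennreal) \<Rightarrow> ennreal" where
  "average Q f = (\<integral>\<^sup>+x\<in>Q. f x \<partial>lebesgue) / emeasure lebesgue Q"

definition A_const :: "real \<Rightarrow> (real ^ 'n \<Rightarrow> ennreal) \<Rightarrow> ennreal" where
  "A_const q w =
     (SUP Q\<in>cubes. average Q w *
        ennpow (average Q (\<lambda>x. ennpow (w x) (1 - conj_exp q))) (q - 1))"

definition A_class :: "real \<Rightarrow> (real ^ 'n \<Rightarrow> ennreal) set" where
  "A_class q = {w. weight w \<and> A_const q w < \<infinity>}"

definition A_infinity :: "(real ^ 'n \<Rightarrow> ennreal) set" where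
  "A_infinity = (\<Union>q\<in>{1<..}. A_class q)"

text \<open>A vector \<open>(p\<^sub>1, \<dots>, p\<^sub>m)\<close> is a function on \<open>nat\<close> of which only the values on \<open>{1..m}\<close> are used.\<close>

definition multi_exp :: "nat \<Rightarrow> (nat \<Rightarrow> real) \<Rightarrow> real" where
  "multi_exp m ps = 1 / (\<Sum>i=1..m. 1 / ps i)"

definition multi_weight ::
  "nat \<Rightarrow> (nat \<Rightarrow> real) \<Rightarrow> (nat \<Rightarrow> real ^ 'n \<Rightarrow> ennreal) \<Rightarrow> real ^ 'n \<Rightarrow> ennreal" where
  "multi_weight m ps ws x = (\<Prod>i=1..m. ennpow (ws i x) (multi_exp m ps / ps i))"

definition multi_A_const ::
  "nat \<Rightarrow> (nat \<Rightarrow> real) \<Rightarrow> (nat \<Rightarrow> real ^ 'n \<Rightarrow> ennreal) \<Rightarrow> ennreal" where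
  "multi_A_const m ps ws =
     (SUP Q\<in>cubes. ennpow (average Q (multi_weight m ps ws)) (1 / multi_exp m ps) *
        (\<Prod>i=1..m. ennpow (average Q (\<lambda>x. ennpow (ws i x) (1 - conj_exp (ps i))))
                           (1 / conj_exp (ps i))))"

definition multi_A_class ::
  "nat \<Rightarrow> (nat \<Rightarrow> real) \<Rightarrow> (nat \<Rightarrow> real ^ 'n \<Rightarrow> ennreal) set" where
  "multi_A_class m ps = {ws. (\<forall>i\<in>{1..m}. weight (ws i)) \<and> multi_A_const m ps ws < \<infinity>}"

end

theory Submission
  imports Defs
begin

text \<open>
  The hypothesis \<open>w\<^sub>i \<in> A\<^sub>\<infinity>\<close> supplies a lower bound for the average of the product weight
  \<open>w = \<Prod> w\<^sub>i\<^bsup>p/p\<^sub>i\<^esup>\<close>. Fix a cube and write \<open>W\<^sub>i\<close>, \<open>S\<^sub>i\<close>, \<open>V\<close> for the averages of \<open>w\<^sub>i\<close>,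
  of \<open>w\<^sub>i\<close> to the power \<open>1 - p\<^sub>i'\<close>, and of \<open>w\<close>. Hoelder's inequality always gives
  \<open>V \<le> \<Prod> W\<^sub>i\<^bsup>p/p\<^sub>i\<^esup>\<close>; for \<open>A\<^sub>\<infinity>\<close> weights it can be reversed up to a constant that does not
  depend on the cube (lemma \<open>prod_average_powr_le_average_prod\<close>). The reason is that an
  \<open>A\<^sub>q\<close> weight has an arithmetic mean comparable with its geometric mean, and geometric means
  are multiplicative.

  Inserting the reversed inequality into the multilinear condition bounds the product over \<open>i\<close>
  of the numbers \<open>g\<^sub>i = W\<^sub>i\<^bsup>1/p\<^sub>i\<^esup> S\<^sub>i\<^bsup>1/p\<^sub>i'\<^esup>\<close> by a constant \<open>D\<close> that is the same for
  all cubes. Hoelder's inequality gives \<open>g\<^sub>i \<ge> 1\<close> (lemma \<open>dual_averages_ge_1\<close>), so no factor can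
  compensate for a large one: each \<open>g\<^sub>i\<close> is itself at most \<open>D\<close>. The expression in the \<open>A\<close>
  condition for \<open>w\<^sub>i\<close> and exponent \<open>p\<^sub>i\<close> is \<open>g\<^sub>i\<close> to the power \<open>p\<^sub>i\<close>, whence its supremum over
  cubes is at most \<open>D\<close> to the power \<open>p\<^sub>i\<close>.

  Both uses of Hoelder's inequality are instances of lemma \<open>prod_averages_ge_1\<close>. Negative
  powers take the place of logarithms in it, so that no integrability of \<open>ln \<circ> w\<^sub>i\<close> has to be
  discussed. The averages themselves are values in \<open>[0,\<infinity>]\<close>; they are positive because weights
  are, and then finite because a product of positive factors is finite only if all factors are.
  After that the argument is one about positive real numbers.
\<close>

section \<open>Real powers on the extended half-line\<close>

lemma ennpow_eq_powr:
  assumes "0 < x" "x < \<infinity>"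
  shows "ennpow x a = ennreal (enn2real x powr a)"
proof -
  have "enn2real x > 0"
    using assms by (simp add: enn2real_positive_iff)
  then show ?thesis
    using assms by (auto simp: ennpow_def)
qed

lemma enn2real_ennpow:
  assumes "0 < x" "x < \<infinity>"
  shows "enn2real (ennpow x a) = enn2real x powr a"
  using assms by (simp add: ennpow_eq_powr)

lemma ennpow_in_range:
  assumes "0 < x" "x < \<infinity>"
  shows "0 < ennpow x a" "ennpow x a < \<infinity>"
  using assms enn2real_positive_iff[of x] by (auto simp: ennpow_eq_powr)

lemma ennpow_pos:
  assumes "0 < x" "0 < a"
  shows "0 < ennpow x a"
  using assms enn2real_positive_iff[of x] by (auto simp: ennpow_def top.not_eq_extremum)

lemma ennpow_finite_imp_finite:
  assumes "ennpow x a < \<infinity>" "0 < a"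
  shows "x < \<infinity>"
  using assms by (auto simp: ennpow_def top.not_eq_extremum split: if_splits)

lemma measurable_ennpow [measurable (raw)]:
  assumes [measurable]: "f \<in> borel_measurable M"
  shows "(\<lambda>x. ennpow (f x) a) \<in> borel_measurable M"
  unfolding ennpow_def by measurable

lemma ennreal_mult_finite_imp:
  fixes a b :: ennreal
  assumes "a * b < \<infinity>" "0 < a" "0 < b"
  shows "a < \<infinity>" "b < \<infinity>"
  using assms by (auto simp: ennreal_mult_eq_top_iff top.not_eq_extremum[symmetric])

lemma ennreal_prod_pos:
  fixes f :: "'i \<Rightarrow> ennreal"
  assumes "\<And>i. i \<in> I \<Longrightarrow> 0 < f i"
  shows "0 < prod f I"
  using assms
  by (induction I rule: infinite_finite_induct) (auto simp: ennreal_zero_less_mult_iff)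

lemma ennreal_prod_finite_imp:
  fixes f :: "'i \<Rightarrow> ennreal"
  assumes "finite I" "\<And>i. i \<in> I \<Longrightarrow> 0 < f i" "prod f I < \<infinity>" "i \<in> I"
  shows "f i < \<infinity>"
proof -
  have "prod f I = f i * prod f (I - {i})"
    using assms by (simp add: prod.remove)
  moreover have "0 < prod f (I - {i})"
    using assms by (intro ennreal_prod_pos) auto
  ultimately show ?thesis
    using ennreal_mult_finite_imp(1) assms by metis
qed

lemma enn2real_prod:
  "enn2real (prod f I) = (\<Prod>i\<in>I. enn2real (f i))"
  by (induction I rule: infinite_finite_induct) (auto simp: enn2real_mult)

section \<open>Averages over cubes\<close>

lemma cube_measure:
  fixes Q :: "(real ^ 'n) set"
  assumes "Q \<in> cubes"
  shows "Q \<in> sets lebesgue" "0 < emeasure lebesgue Q" "emeasure lebesgue Q < \<infinity>"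
proof -
  obtain a l where Q: "Q = cbox a (\<chi> i. a $ i + l)" and l: "0 < l"
    using assms by (auto simp: cubes_def)
  have "(\<Prod>b\<in>Basis. ((\<chi> i. a $ i + l) - a) \<bullet> b) > 0"
    using l by (intro prod_pos) (auto simp: Basis_vec_def inner_axis)
  moreover have "emeasure lebesgue Q = (\<Prod>b\<in>Basis. ((\<chi> i. a $ i + l) - a) \<bullet> b)"
    unfolding Q using l
    by (subst emeasure_lborel_cbox[symmetric]) (auto simp: Basis_vec_def inner_axis)
  ultimately show "0 < emeasure lebesgue Q" "emeasure lebesgue Q < \<infinity>"
    by auto
  show "Q \<in> sets lebesgue"
    by (simp add: Q)
qed

lemma average_const:
  assumes "Q \<in> cubes"
  shows "average Q (\<lambda>x. c) = c"
proof -
  have "average Q (\<lambda>x. c) = c * emeasure lebesgue Q / emeasure lebesgue Q"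
    using cube_measure[OF assms] by (simp add: average_def nn_integral_cmult_indicator)
  then show ?thesis
    using cube_measure[OF assms] by (simp add: ennreal_mult_divide_eq)
qed

lemma average_mono_AE:
  assumes "AE x in lebesgue. f x \<le> g x"
  shows "average Q f \<le> average Q g"
  unfolding average_def using assms
  by (intro divide_right_mono_ennreal nn_integral_mono_AE) (auto elim!: eventually_mono simp: mult_right_mono)

lemma average_sum_cmult:
  assumes "Q \<in> cubes" and [measurable]: "\<And>j. j \<in> J \<Longrightarrow> f j \<in> borel_measurable lebesgue"
  shows "average Q (\<lambda>x. \<Sum>j\<in>J. c j * f j x) = (\<Sum>j\<in>J. c j * average Q (f j))"
proof -
  have [measurable]: "Q \<in> sets lebesgue"
    using cube_measure(1)[OF assms(1)] .
  have "(\<integral>\<^sup>+x\<in>Q. (\<Sum>j\<in>J. c j * f j x) \<partial>lebesgue)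
      = (\<integral>\<^sup>+x. (\<Sum>j\<in>J. c j * (f j x * indicator Q x)) \<partial>lebesgue)"
    by (simp add: sum_distrib_right mult.assoc)
  also have "\<dots> = (\<Sum>j\<in>J. c j * (\<integral>\<^sup>+x\<in>Q. f j x \<partial>lebesgue))"
    by (subst nn_integral_sum) (auto intro!: sum.cong nn_integral_cmult)
  finally show ?thesis
    by (simp add: average_def divide_ennreal_def sum_distrib_right mult.assoc)
qed

lemma average_pos:
  assumes "Q \<in> cubes" and [measurable]: "f \<in> borel_measurable lebesgue"
    and "AE x in lebesgue. 0 < f x"
  shows "0 < average Q f"
proof (rule ccontr)
  assume "\<not> 0 < average Q f"
  have [measurable]: "Q \<in> sets lebesgue"
    using cube_measure(1)[OF assms(1)] .
  have "(\<integral>\<^sup>+x\<in>Q. f x \<partial>lebesgue) = 0"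
    using \<open>\<not> 0 < average Q f\<close> cube_measure(3)[OF assms(1)]
    by (auto simp: average_def ennreal_divide_eq_0_iff)
  then have "AE x in lebesgue. f x * indicator Q x = 0"
    by (subst (asm) nn_integral_0_iff_AE) auto
  with assms(3) have "AE x in lebesgue. x \<notin> Q"
    by eventually_elim (auto simp: indicator_def split: if_splits)
  then have "emeasure lebesgue Q = 0"
    by (subst (asm) AE_iff_null_sets[symmetric]) auto
  with cube_measure(2)[OF assms(1)] show False
    by simp
qed

section \<open>A geometric-mean form of Hoelder's inequality\<close>

lemma weighted_arith_geom_mean:
  fixes y c :: "'j \<Rightarrow> real"
  assumes "finite J" "\<And>j. j \<in> J \<Longrightarrow> 0 \<le> c j" "sum c J = 1" "\<And>j. j \<in> J \<Longrightarrow> 0 < y j"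
  shows "(\<Prod>j\<in>J. y j powr c j) \<le> (\<Sum>j\<in>J. c j * y j)"
proof -
  have "J \<noteq> {}"
    using assms(3) by auto
  have "(\<Prod>j\<in>J. y j powr c j) = (\<Prod>j\<in>J. exp (c j * ln (y j)))"
    using assms(4) by (intro prod.cong) (force simp: powr_def)+
  also have "\<dots> = exp (\<Sum>j\<in>J. c j *\<^sub>R ln (y j))"
    using assms(1) by (simp add: exp_sum)
  also have "\<dots> \<le> (\<Sum>j\<in>J. c j * exp (ln (y j)))"
    using assms \<open>J \<noteq> {}\<close> by (intro convex_on_sum[OF _ _ exp_convex]) auto
  also have "\<dots> = (\<Sum>j\<in>J. c j * y j)"
    using assms(4) by (intro sum.cong) simp_all
  finally show ?thesis .
qed

text \<open>
  The geometric mean of the averages dominates the average of the geometric mean, which here is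
  the constant \<open>1\<close>. Dividing each function by its average and applying the weighted inequality
  of arithmetic and geometric means pointwise bounds \<open>1 / \<Prod> A\<^sub>j\<^bsup>c\<^sub>j\<^esup>\<close> by a function
  whose average is \<open>\<Sum> c\<^sub>j = 1\<close>.
\<close>

lemma prod_averages_ge_1:
  fixes f :: "'j \<Rightarrow> real ^ 'n \<Rightarrow> ennreal" and c :: "'j \<Rightarrow> real"
  assumes Q: "Q \<in> cubes" and J: "finite J"
    and c: "\<And>j. j \<in> J \<Longrightarrow> 0 \<le> c j" "sum c J = 1"
    and meas: "\<And>j. j \<in> J \<Longrightarrow> f j \<in> borel_measurable lebesgue"
    and range: "AE x in lebesgue. \<forall>j\<in>J. 0 < f j x \<and> f j x < \<infinity>"
    and prod1: "AE x in lebesgue. (\<Prod>j\<in>J. enn2real (f j x) powr c j) = 1"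
    and avg: "\<And>j. j \<in> J \<Longrightarrow> 0 < average Q (f j)" "\<And>j. j \<in> J \<Longrightarrow> average Q (f j) < \<infinity>"
  shows "1 \<le> (\<Prod>j\<in>J. enn2real (average Q (f j)) powr c j)"
proof -
  define A where "A j = enn2real (average Q (f j))" for j
  have A: "A j > 0" "average Q (f j) = ennreal (A j)" if "j \<in> J" for j
    using avg that by (auto simp: A_def enn2real_positive_iff)
  define P where "P = (\<Prod>j\<in>J. A j powr c j)"
  have P: "P > 0"
    unfolding P_def using A(1) by (intro prod_pos) force
  have "AE x in lebesgue. ennreal (1 / P) \<le> (\<Sum>j\<in>J. ennreal (c j / A j) * f j x)"
    using range prod1
  proof eventually_elim
    case (elim x)
    define y where "y j = enn2real (f j x)" for j
    have y: "y j > 0" "f j x = ennreal (y j)" if "j \<in> J" for j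
      using elim(1) that by (auto simp: y_def enn2real_positive_iff)
    have "1 / P = (\<Prod>j\<in>J. (y j / A j) powr c j)"
      using elim(2) A(1) y(1)
      by (simp add: P_def y_def prod_dividef powr_divide less_imp_le)
    also have "\<dots> \<le> (\<Sum>j\<in>J. c j * (y j / A j))"
      using A(1) y(1) c J by (intro weighted_arith_geom_mean) auto
    finally have "ennreal (1 / P) \<le> ennreal (\<Sum>j\<in>J. c j / A j * y j)"
      by (simp add: ennreal_leI)
    also have "\<dots> = (\<Sum>j\<in>J. ennreal (c j / A j * y j))"
      using A(1) y(1) c(1) by (intro sum_ennreal[symmetric] mult_nonneg_nonneg divide_nonneg_nonneg) (auto simp: less_imp_le)
    also have "\<dots> = (\<Sum>j\<in>J. ennreal (c j / A j) * f j x)"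
    proof (intro sum.cong refl)
      fix j assume "j \<in> J"
      then show "ennreal (c j / A j * y j) = ennreal (c j / A j) * f j x"
        unfolding y(2)[OF \<open>j \<in> J\<close>] using A(1)[of j] y(1)[of j] c(1)[of j]
        by (intro ennreal_mult) auto
    qed
    finally show ?case .
  qed
  then have "average Q (\<lambda>x. ennreal (1 / P)) \<le> average Q (\<lambda>x. \<Sum>j\<in>J. ennreal (c j / A j) * f j x)"
    by (rule average_mono_AE)
  also have "\<dots> = (\<Sum>j\<in>J. ennreal (c j / A j) * average Q (f j))"
    using Q meas by (rule average_sum_cmult)
  also have "\<dots> = (\<Sum>j\<in>J. ennreal (c j))"
  proof (intro sum.cong refl)
    fix j assume "j \<in> J"
    with A[of j] c(1)[of j] have "ennreal (c j / A j) * average Q (f j) = ennreal (c j / A j * A j)"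
      by (metis ennreal_mult divide_nonneg_pos less_imp_le)
    with A(1)[OF \<open>j \<in> J\<close>] show "ennreal (c j / A j) * average Q (f j) = ennreal (c j)"
      by simp
  qed
  also have "\<dots> = 1"
    using c by (simp add: sum_ennreal)
  finally have "1 / P \<le> 1"
    using Q by (simp add: average_const)
  then show ?thesis
    using P by (simp add: P_def A_def)
qed

section \<open>Weights\<close>

lemma weight_measurable: "weight w \<Longrightarrow> w \<in> borel_measurable lebesgue"
  by (simp add: weight_def)

lemma weight_range: "weight w \<Longrightarrow> AE x in lebesgue. 0 < w x \<and> w x < \<infinity>"
  by (simp add: weight_def)

lemma weight_ennpow:
  assumes "weight w"
  shows "weight (\<lambda>x. ennpow (w x) a)"
  unfolding weight_def
proof
  have [measurable]: "w \<in> borel_measurable lebesgue"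
    using assms by (rule weight_measurable)
  show "(\<lambda>x. ennpow (w x) a) \<in> borel_measurable lebesgue"
    by measurable
  show "AE x in lebesgue. 0 < ennpow (w x) a \<and> ennpow (w x) a < \<infinity>"
    using weight_range[OF assms] by eventually_elim (use ennpow_in_range in auto)
qed

lemma weight_prod:
  assumes "finite I" "\<And>i. i \<in> I \<Longrightarrow> weight (ws i)"
  shows "weight (\<lambda>x. \<Prod>i\<in>I. ws i x)"
  unfolding weight_def
proof
  have [measurable]: "ws i \<in> borel_measurable lebesgue" if "i \<in> I" for i
    using assms that by (simp add: weight_measurable)
  show "(\<lambda>x. \<Prod>i\<in>I. ws i x) \<in> borel_measurable lebesgue"
    by measurable
  have "AE x in lebesgue. \<forall>i\<in>I. 0 < ws i x \<and> ws i x < \<infinity>"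
    using assms by (intro AE_finite_allI weight_range)
  then show "AE x in lebesgue. 0 < (\<Prod>i\<in>I. ws i x) \<and> (\<Prod>i\<in>I. ws i x) < \<infinity>"
  proof eventually_elim
    case (elim x)
    then show ?case
      using ennreal_prod_pos[of I "\<lambda>i. ws i x"]
      by (auto simp: ennreal_prod_eq_top less_top[symmetric])
  qed
qed

lemma weight_average_pos:
  assumes "weight w" "Q \<in> cubes"
  shows "0 < average Q w"
  using average_pos[OF assms(2) weight_measurable[OF assms(1)]] weight_range[OF assms(1)]
  by (auto elim: eventually_mono)

text \<open>
  Finiteness of the supremum alone yields local integrability of \<open>w\<close> and of its dual power: both
  averages are positive, so neither can be infinite without making the product infinite.
\<close>

lemma A_class_on_cube:
  assumes w: "w \<in> A_class q" and q: "1 < q" and Q: "Q \<in> cubes"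
  defines "W \<equiv> average Q w" and "T \<equiv> average Q (\<lambda>x. ennpow (w x) (1 - conj_exp q))"
  shows "W < \<infinity>" "T < \<infinity>"
    "enn2real W * enn2real T powr (q - 1) \<le> enn2real (A_const q w)"
proof -
  have ww: "weight w" and fin: "A_const q w < \<infinity>"
    using w by (auto simp: A_class_def)
  have le: "W * ennpow T (q - 1) \<le> A_const q w"
    unfolding A_const_def W_def T_def using Q by (rule SUP_upper)
  have pos: "0 < W" "0 < T"
    unfolding W_def T_def using ww Q by (auto intro!: weight_average_pos weight_ennpow)
  have powpos: "0 < ennpow T (q - 1)"
    using pos q by (simp add: ennpow_pos)
  have prodfin: "W * ennpow T (q - 1) < \<infinity>"
    using le fin by (rule le_less_trans)
  show W: "W < \<infinity>"
    using ennreal_mult_finite_imp(1)[OF prodfin pos(1) powpos] .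
  show T: "T < \<infinity>"
    using ennpow_finite_imp_finite[OF ennreal_mult_finite_imp(2)[OF prodfin pos(1) powpos]] q by simp
  have "enn2real (W * ennpow T (q - 1)) \<le> enn2real (A_const q w)"
    using le fin by (intro enn2real_mono) auto
  then show "enn2real W * enn2real T powr (q - 1) \<le> enn2real (A_const q w)"
    using pos T by (simp add: enn2real_mult enn2real_ennpow)
qed

lemma one_minus_conj_exp: "1 < q \<Longrightarrow> 1 - conj_exp q = - 1 / (q - 1)"
  by (simp add: conj_exp_def field_simps)

text \<open>
  Hoelder's inequality for \<open>1 = w\<^bsup>1/q\<^esup> w\<^bsup>-1/q\<^esup>\<close>: since \<open>(1 - q') / q' = - 1 / q\<close>, the pair
  \<open>w\<close>, \<open>w\<^bsup>1-q'\<^esup>\<close> with exponents \<open>1/q\<close>, \<open>1/q'\<close> has geometric mean \<open>1\<close>.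
\<close>

lemma dual_averages_ge_1:
  assumes w: "weight w" and q: "1 < q" and Q: "Q \<in> cubes"
  defines "W \<equiv> average Q w" and "S \<equiv> average Q (\<lambda>x. ennpow (w x) (1 - conj_exp q))"
  assumes fin: "W < \<infinity>" "S < \<infinity>"
  shows "1 \<le> enn2real W powr (1 / q) * enn2real S powr (1 / conj_exp q)"
proof -
  define f where "f = (\<lambda>b x. if b then w x else ennpow (w x) (1 - conj_exp q))"
  define c where "c = (\<lambda>b. if b then 1 / q else 1 / conj_exp q)"
  have f: "weight (f b)" for b
    using w weight_ennpow[OF w] by (cases b) (auto simp: f_def)
  have favg: "average Q (f True) = W" "average Q (f False) = S"
    by (auto simp: f_def W_def S_def)
  have "1 \<le> (\<Prod>b\<in>UNIV. enn2real (average Q (f b)) powr c b)"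
  proof (rule prod_averages_ge_1[OF Q])
    show "AE x in lebesgue. (\<Prod>b\<in>UNIV. enn2real (f b x) powr c b) = 1"
      using weight_range[OF w]
    proof eventually_elim
      case (elim x)
      then have "enn2real (w x) > 0"
        by (simp add: enn2real_positive_iff)
      moreover have "1 / q + (1 - conj_exp q) * (1 / conj_exp q) = 0"
        using q by (simp add: conj_exp_def field_simps)
      ultimately show ?case
        using elim by (simp add: UNIV_bool f_def c_def enn2real_ennpow powr_powr powr_add[symmetric] add.commute)
    qed
    show "AE x in lebesgue. \<forall>b\<in>UNIV. 0 < f b x \<and> f b x < \<infinity>"
      using f by (intro AE_finite_allI weight_range) auto
    show "average Q (f b) < \<infinity>" for b
      using fin favg by (cases b) auto
    show "sum c UNIV = 1"
      using q by (simp add: UNIV_bool c_def conj_exp_def field_simps)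
    show "0 \<le> c b" for b
      using q by (simp add: c_def conj_exp_def)
  qed (auto intro: weight_measurable weight_average_pos f Q)
  then show ?thesis
    by (simp add: UNIV_bool c_def favg mult.commute)
qed

text \<open>
  The reversed Hoelder inequality. Let \<open>T\<^sub>i\<close> be the average of \<open>w\<^sub>i\<close> to the power
  \<open>1 - q\<^sub>i' = - 1 / (q\<^sub>i - 1)\<close>. The product weight, taken with exponent \<open>a\<close>, cancels against
  these dual powers, taken with exponents \<open>a \<theta>\<^sub>i (q\<^sub>i - 1)\<close>; the exponents add up to \<open>1\<close>
  exactly when \<open>a = 1 / \<Sum> \<theta>\<^sub>i q\<^sub>i\<close>. Hence \<open>1 \<le> V \<Prod> T\<^sub>i\<^bsup>\<theta>\<^sub>i (q\<^sub>i - 1)\<^esup>\<close>, and the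
  condition \<open>A\<close> with exponent \<open>q\<^sub>i\<close> replaces \<open>T\<^sub>i\<^bsup>q\<^sub>i - 1\<^esup>\<close> by \<open>C\<^sub>i / W\<^sub>i\<close>.
\<close>

lemma prod_average_powr_le_average_prod:
  fixes ws :: "'i \<Rightarrow> real ^ 'n \<Rightarrow> ennreal" and \<theta> q :: "'i \<Rightarrow> real"
  assumes I: "finite I" and \<theta>: "\<And>i. i \<in> I \<Longrightarrow> 0 \<le> \<theta> i" "sum \<theta> I = 1"
    and q: "\<And>i. i \<in> I \<Longrightarrow> 1 < q i"
    and ws: "\<And>i. i \<in> I \<Longrightarrow> ws i \<in> A_class (q i)"
    and Q: "Q \<in> cubes"
  defines "V \<equiv> average Q (\<lambda>x. \<Prod>i\<in>I. ennpow (ws i x) (\<theta> i))"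
  assumes V: "V < \<infinity>"
  shows "(\<Prod>i\<in>I. enn2real (average Q (ws i)) powr \<theta> i)
       \<le> (\<Prod>i\<in>I. enn2real (A_const (q i) (ws i)) powr \<theta> i) * enn2real V"
proof -
  define W where "W i = enn2real (average Q (ws i))" for i
  define T where "T i = enn2real (average Q (\<lambda>x. ennpow (ws i x) (1 - conj_exp (q i))))" for i
  define C where "C i = enn2real (A_const (q i) (ws i))" for i
  have weights: "weight (ws i)" if "i \<in> I" for i
    using ws[OF that] by (simp add: A_class_def)
  have wprod: "weight (\<lambda>x. \<Prod>i\<in>I. ennpow (ws i x) (\<theta> i))"
    using I weights by (intro weight_prod weight_ennpow) auto
  have Vpos: "0 < V"
    unfolding V_def using wprod Q by (rule weight_average_pos)
  have WT: "W i > 0" "T i > 0" "W i * T i powr (q i - 1) \<le> C i" if "i \<in> I" for i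
    using A_class_on_cube[OF ws[OF that] q[OF that] Q]
      weight_average_pos[OF weights[OF that] Q]
      weight_average_pos[OF weight_ennpow[OF weights[OF that]] Q]
    by (auto simp: W_def T_def C_def enn2real_positive_iff)
  define a where "a = 1 / (\<Sum>i\<in>I. \<theta> i * q i)"
  have sum_ge: "(\<Sum>i\<in>I. \<theta> i * q i) \<ge> 1"
  proof -
    have "(\<Sum>i\<in>I. \<theta> i * 1) \<le> (\<Sum>i\<in>I. \<theta> i * q i)"
      using \<theta>(1) q by (intro sum_mono mult_left_mono) (auto simp: less_imp_le)
    with \<theta>(2) show ?thesis by simp
  qed
  then have a: "a > 0"
    by (simp add: a_def)
  \<comment> \<open>The index \<open>None\<close> stands for the product weight, \<open>Some i\<close> for the dual power of the \<open>i\<close>-th weight.\<close>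
  define f where "f = (\<lambda>k x. case k of None \<Rightarrow> \<Prod>i\<in>I. ennpow (ws i x) (\<theta> i)
      | Some i \<Rightarrow> ennpow (ws i x) (1 - conj_exp (q i)))"
  define c where "c = (\<lambda>k. case k of None \<Rightarrow> a | Some i \<Rightarrow> a * (\<theta> i * (q i - 1)))"
  define J where "J = insert None (Some ` I)"
  have wf: "weight (f k)" if "k \<in> J" for k
    using that wprod weight_ennpow[OF weights] by (auto simp: f_def J_def)
  have sumJ: "sum h J = h None + (\<Sum>i\<in>I. h (Some i))" for h :: "'i option \<Rightarrow> real"
    using I by (simp add: J_def sum.reindex)
  have prodJ: "prod h J = h None * (\<Prod>i\<in>I. h (Some i))" for h :: "'i option \<Rightarrow> real"
    using I by (simp add: J_def prod.reindex)
  have "1 \<le> (\<Prod>k\<in>J. enn2real (average Q (f k)) powr c k)"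
  proof (rule prod_averages_ge_1[OF Q])
    show "finite J"
      using I by (simp add: J_def)
    show "0 \<le> c k" if "k \<in> J" for k
      using that a \<theta>(1) q by (auto simp: c_def J_def less_imp_le)
    have "sum c J = a * (1 + (\<Sum>i\<in>I. \<theta> i * (q i - 1)))"
      by (simp add: sumJ c_def sum_distrib_left[symmetric] distrib_left)
    also have "1 + (\<Sum>i\<in>I. \<theta> i * (q i - 1)) = (\<Sum>i\<in>I. \<theta> i * q i)"
      using \<theta>(2) by (simp add: right_diff_distrib sum_subtractf)
    finally show "sum c J = 1"
      using sum_ge by (simp add: a_def)
    show "AE x in lebesgue. \<forall>k\<in>J. 0 < f k x \<and> f k x < \<infinity>"
      using wf \<open>finite J\<close> by (intro AE_finite_allI weight_range) auto
    have "AE x in lebesgue. \<forall>i\<in>I. 0 < ws i x \<and> ws i x < \<infinity>"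
      using weights I by (intro AE_finite_allI weight_range) auto
    then show "AE x in lebesgue. (\<Prod>k\<in>J. enn2real (f k x) powr c k) = 1"
    proof eventually_elim
      case (elim x)
      have pos: "enn2real (ws i x) > 0" if "i \<in> I" for i
        using elim that by (simp add: enn2real_positive_iff)
      have e1: "enn2real (f None x) powr c None = (\<Prod>i\<in>I. enn2real (ws i x) powr (\<theta> i * a))"
        using elim by (simp add: f_def c_def enn2real_prod enn2real_ennpow prod_powr_distrib powr_powr)
      have e2: "enn2real (f (Some i) x) powr c (Some i) = enn2real (ws i x) powr (- (\<theta> i * a))"
        if "i \<in> I" for i
      proof -
        have "(1 - conj_exp (q i)) * (a * (\<theta> i * (q i - 1))) = - (\<theta> i * a)"
          using q[OF that] by (simp add: one_minus_conj_exp)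
        then show ?thesis
          using elim that by (simp add: f_def c_def enn2real_ennpow powr_powr)
      qed
      show ?case
        by (auto simp: prodJ e1 e2 prod.distrib[symmetric] powr_add[symmetric] dest: pos
            intro!: prod.neutral)
    qed
    show "average Q (f k) < \<infinity>" if "k \<in> J" for k
      using that V A_class_on_cube(2)[OF ws q Q] by (auto simp: f_def J_def V_def)
  qed (auto intro: weight_measurable weight_average_pos wf Q)
  then have "1 \<le> enn2real V powr a * (\<Prod>i\<in>I. T i powr (a * (\<theta> i * (q i - 1))))"
    by (simp add: prodJ f_def c_def V_def T_def)
  also have "\<dots> = (enn2real V * (\<Prod>i\<in>I. T i powr (\<theta> i * (q i - 1)))) powr a"
    by (simp add: powr_mult prod_nonneg prod_powr_distrib powr_powr mult.commute)
  finally have "1 powr (1 / a) \<le> ((enn2real V * (\<Prod>i\<in>I. T i powr (\<theta> i * (q i - 1)))) powr a) powr (1 / a)"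
    using a by (intro powr_mono2) auto
  then have key: "1 \<le> enn2real V * (\<Prod>i\<in>I. T i powr (\<theta> i * (q i - 1)))"
    using a by (simp add: powr_powr prod_nonneg)
  have "(\<Prod>i\<in>I. W i powr \<theta> i) * 1
      \<le> (\<Prod>i\<in>I. W i powr \<theta> i) * (enn2real V * (\<Prod>i\<in>I. T i powr (\<theta> i * (q i - 1))))"
    using key by (intro mult_left_mono prod_nonneg) auto
  also have "\<dots> = (\<Prod>i\<in>I. (W i * T i powr (q i - 1)) powr \<theta> i) * enn2real V"
  proof -
    have "(W i * T i powr (q i - 1)) powr \<theta> i = W i powr \<theta> i * T i powr (\<theta> i * (q i - 1))"
      if "i \<in> I" for i
      using WT[OF that] by (simp add: powr_mult powr_powr mult.commute)
    then show ?thesis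
      by (simp add: prod.distrib)
  qed
  also have "\<dots> \<le> (\<Prod>i\<in>I. C i powr \<theta> i) * enn2real V"
    using WT \<theta>(1) by (intro mult_right_mono prod_mono conjI powr_mono2) (auto simp: less_imp_le)
  finally show ?thesis
    by (simp add: W_def C_def)
qed

section \<open>The multilinear class\<close>

lemma factor_le_prod:
  fixes g :: "'i \<Rightarrow> real"
  assumes "finite I" "i \<in> I" "\<And>k. k \<in> I \<Longrightarrow> 1 \<le> g k"
  shows "g i \<le> prod g I"
proof -
  have "g i * 1 \<le> g i * prod g (I - {i})"
    using assms by (intro mult_left_mono prod_ge_1) (auto intro: order_trans[of 0 1])
  then show ?thesis
    using assms by (simp add: prod.remove)
qed

lemma multi_exp_pos:
  assumes "1 \<le> m" "\<forall>i\<in>{1..m}. 1 < ps i"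
  shows "0 < multi_exp m ps"
  unfolding multi_exp_def using assms
  by (intro divide_pos_pos sum_pos) force+

text \<open>
  As in the case of a single weight, positivity of all the averages turns finiteness of the
  supremum into finiteness of each average.
\<close>

lemma multi_A_on_cube:
  assumes m: "1 \<le> m" and ps: "\<forall>i\<in>{1..m}. 1 < ps i"
    and ws: "ws \<in> multi_A_class m ps" and Q: "Q \<in> cubes"
  defines "V \<equiv> average Q (multi_weight m ps ws)"
    and "S \<equiv> \<lambda>i. average Q (\<lambda>x. ennpow (ws i x) (1 - conj_exp (ps i)))"
  shows "V < \<infinity>" "\<And>i. i \<in> {1..m} \<Longrightarrow> S i < \<infinity>"
    "enn2real V powr (1 / multi_exp m ps) * (\<Prod>i=1..m. enn2real (S i) powr (1 / conj_exp (ps i)))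
      \<le> enn2real (multi_A_const m ps ws)"
proof -
  have weights: "\<And>i. i \<in> {1..m} \<Longrightarrow> weight (ws i)" and fin: "multi_A_const m ps ws < \<infinity>"
    using ws by (auto simp: multi_A_class_def)
  let ?v = "ennpow V (1 / multi_exp m ps)" and ?s = "\<lambda>i. ennpow (S i) (1 / conj_exp (ps i))"
  have le: "?v * (\<Prod>i=1..m. ?s i) \<le> multi_A_const m ps ws"
    unfolding multi_A_const_def V_def S_def using Q by (rule SUP_upper)
  have exp_pos: "0 < 1 / multi_exp m ps" "\<And>i. i \<in> {1..m} \<Longrightarrow> 0 < 1 / conj_exp (ps i)"
    using multi_exp_pos[OF m ps] ps by (force simp: conj_exp_def)+
  have "weight (multi_weight m ps ws)"
    unfolding multi_weight_def using weights by (intro weight_prod weight_ennpow) auto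
  then have V0: "0 < V"
    unfolding V_def using Q by (rule weight_average_pos)
  have S0: "0 < S i" if "i \<in> {1..m}" for i
    unfolding S_def using weights[OF that] Q by (intro weight_average_pos weight_ennpow)
  have v0: "0 < ?v"
    using V0 exp_pos(1) by (rule ennpow_pos)
  have s0: "0 < ?s i" if "i \<in> {1..m}" for i
    using S0[OF that] exp_pos(2)[OF that] by (rule ennpow_pos)
  have ps0: "0 < (\<Prod>i=1..m. ?s i)"
    using s0 by (rule ennreal_prod_pos)
  have pfin: "?v * (\<Prod>i=1..m. ?s i) < \<infinity>"
    using le fin by (rule le_less_trans)
  show V: "V < \<infinity>"
    using ennpow_finite_imp_finite[OF ennreal_mult_finite_imp(1)[OF pfin v0 ps0] exp_pos(1)] .
  show S: "S i < \<infinity>" if "i \<in> {1..m}" for i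
  proof -
    have "?s i < \<infinity>"
      using ennreal_mult_finite_imp(2)[OF pfin v0 ps0] s0 that
      by (intro ennreal_prod_finite_imp[of "{1..m}" ?s i]) auto
    then show ?thesis
      using exp_pos(2)[OF that] by (rule ennpow_finite_imp_finite)
  qed
  have "enn2real (?v * (\<Prod>i=1..m. ?s i)) \<le> enn2real (multi_A_const m ps ws)"
    using le fin by (intro enn2real_mono) auto
  moreover have "enn2real (?s i) = enn2real (S i) powr (1 / conj_exp (ps i))" if "i \<in> {1..m}" for i
    using S0[OF that] S[OF that] by (rule enn2real_ennpow)
  moreover have "enn2real ?v = enn2real V powr (1 / multi_exp m ps)"
    using V0 V by (rule enn2real_ennpow)
  ultimately show "enn2real V powr (1 / multi_exp m ps) * (\<Prod>i=1..m. enn2real (S i) powr (1 / conj_exp (ps i)))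
      \<le> enn2real (multi_A_const m ps ws)"
    by (simp add: enn2real_mult enn2real_prod)
qed

theorem theorem1p6:
  fixes m :: nat
    and ps :: "nat \<Rightarrow> real"
    and ws :: "nat \<Rightarrow> real ^ 'n \<Rightarrow> ennreal"
  assumes "1 \<le> m"
    and "\<forall>i\<in>{1..m}. 1 < ps i"
    and "\<forall>i\<in>{1..m}. weight (ws i)"
    and "ws \<in> multi_A_class m ps"
    and "\<forall>i\<in>{1..m}. ws i \<in> A_infinity"
  shows "\<forall>i\<in>{1..m}. ws i \<in> A_class (ps i)"
proof
  fix i assume i: "i \<in> {1..m}"
  define p where "p = multi_exp m ps"
  have p: "0 < p"
    unfolding p_def using assms(1,2) by (rule multi_exp_pos)
  have "\<forall>k\<in>{1..m}. \<exists>r. 1 < r \<and> ws k \<in> A_class r"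
    using assms(5) by (auto simp: A_infinity_def)
  then obtain q where q: "\<And>k. k \<in> {1..m} \<Longrightarrow> 1 < q k"
      "\<And>k. k \<in> {1..m} \<Longrightarrow> ws k \<in> A_class (q k)"
    by metis
  have sum1: "(\<Sum>k=1..m. p / ps k) = 1"
  proof -
    have "(\<Sum>k=1..m. p / ps k) = p * (\<Sum>k=1..m. 1 / ps k)"
      by (simp add: sum_distrib_left)
    with p show ?thesis
      by (auto simp: p_def multi_exp_def)
  qed
  define K where "K = enn2real (multi_A_const m ps ws)"
  define C where "C k = enn2real (A_const (q k) (ws k))" for k
  \<comment> \<open>A bound, independent of the cube, for the product of all the \<open>g k\<close> introduced below.\<close>
  define D where "D = (\<Prod>k=1..m. C k powr (1 / ps k)) * K"
  have "A_const (ps i) (ws i) \<le> ennreal (D powr ps i)"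
    unfolding A_const_def
  proof (rule SUP_least)
    fix Q :: "(real ^ 'n) set" assume Q: "Q \<in> cubes"
    define S where "S k = average Q (\<lambda>x. ennpow (ws k x) (1 - conj_exp (ps k)))" for k
    define W where "W k = average Q (ws k)" for k
    define V where "V = average Q (multi_weight m ps ws)"
    note multi = multi_A_on_cube[OF assms(1,2,4) Q, folded V_def S_def p_def K_def]
    have W: "0 < W k" "W k < \<infinity>" if "k \<in> {1..m}" for k
      unfolding W_def using A_class_on_cube(1)[OF q(2)[OF that] q(1)[OF that] Q]
        weight_average_pos[OF _ Q] assms(3) that by auto
    have S: "0 < S k" if "k \<in> {1..m}" for k
      unfolding S_def using assms(3) that Q by (auto intro!: weight_average_pos weight_ennpow)
    have "(\<Prod>k=1..m. enn2real (W k) powr (p / ps k)) \<le> (\<Prod>k=1..m. C k powr (p / ps k)) * enn2real V"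
      using prod_average_powr_le_average_prod[of "{1..m}" "\<lambda>k. p / ps k" q ws Q]
        sum1 q Q multi(1) p assms(2)
      by (fastforce simp: V_def W_def C_def p_def multi_weight_def[abs_def])
    then have "(\<Prod>k=1..m. enn2real (W k) powr (p / ps k)) powr (1 / p)
        \<le> ((\<Prod>k=1..m. C k powr (p / ps k)) * enn2real V) powr (1 / p)"
      using p by (intro powr_mono2 prod_nonneg) auto
    then have VW: "(\<Prod>k=1..m. enn2real (W k) powr (1 / ps k))
        \<le> (\<Prod>k=1..m. C k powr (1 / ps k)) * enn2real V powr (1 / p)"
      using p by (simp add: prod_powr_distrib powr_powr powr_mult prod_nonneg)
    define g where "g k = enn2real (W k) powr (1 / ps k) * enn2real (S k) powr (1 / conj_exp (ps k))" for k
    have g1: "1 \<le> g k" if "k \<in> {1..m}" for k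
      using dual_averages_ge_1[of "ws k" "ps k" Q] that assms(2,3) Q W(2) multi(2)
      by (simp add: g_def W_def S_def)
    have "g i \<le> (\<Prod>k=1..m. g k)"
      using i g1 by (intro factor_le_prod) auto
    also have "\<dots> = (\<Prod>k=1..m. enn2real (W k) powr (1 / ps k))
        * (\<Prod>k=1..m. enn2real (S k) powr (1 / conj_exp (ps k)))"
      by (simp add: g_def prod.distrib)
    also have "\<dots> \<le> (\<Prod>k=1..m. C k powr (1 / ps k)) * enn2real V powr (1 / p)
        * (\<Prod>k=1..m. enn2real (S k) powr (1 / conj_exp (ps k)))"
      using VW by (intro mult_right_mono prod_nonneg) auto
    also have "\<dots> \<le> D"
      unfolding D_def mult.assoc using multi(3) by (intro mult_left_mono prod_nonneg) auto
    finally have "g i \<le> D" .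
    then have gD: "g i powr ps i \<le> D powr ps i"
      using g1[OF i] assms(2)[rule_format, OF i] by (intro powr_mono2) auto
    have "1 / conj_exp (ps i) * ps i = ps i - 1"
      using assms(2)[rule_format, OF i] by (simp add: conj_exp_def)
    then have "g i powr ps i = enn2real (W i) * enn2real (S i) powr (ps i - 1)"
      using assms(2) i by (fastforce simp: g_def powr_mult powr_powr)
    moreover have "W i * ennpow (S i) (ps i - 1)
        = ennreal (enn2real (W i) * enn2real (S i) powr (ps i - 1))"
      using W[OF i] S[OF i] multi(2)[OF i] by (simp add: ennpow_eq_powr ennreal_mult)
    ultimately show "average Q (ws i) * ennpow (average Q (\<lambda>x. ennpow (ws i x) (1 - conj_exp (ps i)))) (ps i - 1)
        \<le> ennreal (D powr ps i)"
      using gD by (simp add: W_def S_def ennreal_leI)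
  qed
  then have "A_const (ps i) (ws i) < \<infinity>"
    by (rule le_less_trans) simp
  with assms(3) i show "ws i \<in> A_class (ps i)"
    by (simp add: A_class_def)
qed

end
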